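(* The map $\Phi_2$, which is the identity on objects and sends a binary relation $\theta$ from $X$ to $Y$ to the partitioned binary relation $\Phi_2(\theta):=\Phi_1(\theta)\cup\Phi_1(\theta^{\bowtie})$ on $(X,Y)$, gives rise to a faithful functor from $\mathfrak{B}$ to $\mathfrak{PB}$.
   Context: For finite sets $X,Y$, a partitioned binary relation (PBR) on $(X,Y)$ is a binary relation $\alpha\subseteq (X\coprod Y)^2$ on the disjoint union $X\coprod Y$; $X$ is its domain and $Y$ its codomain; pairs $(a,b)\in\alpha$ are edges. If $X$ and $Y$ overlap, $a^{(d)}$ and $a^{(c)}$ denote $a$ seen in the domain, respectively codomain. Composition: for $\alpha$ a PBR on $(X,Y)$ and $\beta$ a PBR on $(Y,Z)$, an $(\alpha,\beta)$-connected sequence is a finite nonempty sequence $(a_1,b_1),\dots,(a_m,b_m)$ of edges, each taken from $\alpha$ or from $\beta$ and regarded as pairs of elements of $X\coprod Y\coprod Z$, such that no two successive edges are taken from the same PBR and $b_i=a_{i+1}$ for $i=1,\dots,m-1$; it connects $a_1$ to $b_m$. $\beta\circ\alpha$ is the PBR on $(X,Z)$ such that, for $a,b\in X\coprod Z$, $(a,b)\in\beta\circ\alpha$ iff some $(\alpha,\beta)$-connected sequence connects $a$ to $b$. $\mathfrak{PB}$ is the category whose objects are finite sets, with $\mathfrak{PB}(X,Y)$ the set of all PBRs on $(X,Y)$, composition $\circ$, and identity of $X$ the PBR $\varepsilon_X$ consisting exactly of the edges $(x^{(d)},x^{(c)})$ and $(x^{(c)},x^{(d)})$, $x\in X$. $\mathfrak{B}$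 is the category of binary relations: objects are finite sets, $\mathfrak{B}(X,Y)$ is the set of all subsets of $X\times Y$, with the usual composition of relations (boolean matrix multiplication) and the equality relation as identity. $\theta^{\bowtie}\subseteq Y\times X$ denotes the transpose (converse) of $\theta\subseteq X\times Y$. $\Phi_1$ views a relation as a set of edges between the two sets. Explicitly, $\Phi_2(\theta)$ consists of the edges $(x,y)$ and $(y,x)$, for all $(x,y)\in\theta$, where $x$ is viewed in the domain $X$ and $y$ in the codomain $Y$. *)

theory Defs
  imports Main
begin

text \<open>
  Hom-sets are indexed by their source and target and need not be disjoint. Accordingly, composition
  is indexed by three objects: \<open>comp C X Y Z g f\<close> is the composite of \<open>f \<in> hom C X Y\<close>, applied first,
  with \<open>g \<in> hom C Y Z\<close>.
\<close>

record ('o, 'm) cat =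
  obj :: "'o set"
  hom :: "'o \<Rightarrow> 'o \<Rightarrow> 'm set"
  comp :: "'o \<Rightarrow> 'o \<Rightarrow> 'o \<Rightarrow> 'm \<Rightarrow> 'm \<Rightarrow> 'm"
  idn :: "'o \<Rightarrow> 'm"

locale category =
  fixes C :: "('o, 'm) cat"
  assumes idn_closed: "X \<in> obj C \<Longrightarrow> idn C X \<in> hom C X X"
    and comp_closed:
      "\<lbrakk>X \<in> obj C; Y \<in> obj C; Z \<in> obj C; f \<in> hom C X Y; g \<in> hom C Y Z\<rbrakk>
        \<Longrightarrow> comp C X Y Z g f \<in> hom C X Z"
    and comp_idn_left:
      "\<lbrakk>X \<in> obj C; Y \<in> obj C; f \<in> hom C X Y\<rbrakk> \<Longrightarrow> comp C X Y Y (idn C Y) f = f"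
    and comp_idn_right:
      "\<lbrakk>X \<in> obj C; Y \<in> obj C; f \<in> hom C X Y\<rbrakk> \<Longrightarrow> comp C X X Y f (idn C X) = f"
    and comp_assoc:
      "\<lbrakk>W \<in> obj C; X \<in> obj C; Y \<in> obj C; Z \<in> obj C;
        f \<in> hom C W X; g \<in> hom C X Y; h \<in> hom C Y Z\<rbrakk>
        \<Longrightarrow> comp C W X Z (comp C X Y Z h g) f = comp C W Y Z h (comp C W X Y g f)"

locale category_functor = C: category C + D: category D
  for C :: "('o, 'm) cat" and D :: "('p, 'n) cat" +
  fixes Fobj :: "'o \<Rightarrow> 'p" and Farr :: "'o \<Rightarrow> 'o \<Rightarrow> 'm \<Rightarrow> 'n"
  assumes obj_closed: "X \<in> obj C \<Longrightarrow> Fobj X \<in> obj D"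
    and arr_closed:
      "\<lbrakk>X \<in> obj C; Y \<in> obj C; f \<in> hom C X Y\<rbrakk> \<Longrightarrow> Farr X Y f \<in> hom D (Fobj X) (Fobj Y)"
    and map_idn: "X \<in> obj C \<Longrightarrow> Farr X X (idn C X) = idn D (Fobj X)"
    and map_comp:
      "\<lbrakk>X \<in> obj C; Y \<in> obj C; Z \<in> obj C; f \<in> hom C X Y; g \<in> hom C Y Z\<rbrakk>
        \<Longrightarrow> Farr X Z (comp C X Y Z g f) =
            comp D (Fobj X) (Fobj Y) (Fobj Z) (Farr Y Z g) (Farr X Y f)"

locale faithful_functor = category_functor +
  assumes faithful: "\<lbrakk>X \<in> obj C; Y \<in> obj C\<rbrakk> \<Longrightarrow> inj_on (Farr X Y) (hom C X Y)"

text \<open>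
  The objects are the finite subsets of an arbitrary type \<open>'a\<close>. The relational product \<open>(O)\<close> is
  written in diagrammatic order.
\<close>

definition rel_cat :: "('a set, ('a \<times> 'a) set) cat" where
  "rel_cat =
    \<lparr>obj = {X. finite X},
     hom = (\<lambda>X Y. Pow (X \<times> Y)),
     comp = (\<lambda>X Y Z \<eta> \<theta>. \<theta> O \<eta>),
     idn = Id_on\<rparr>"

text \<open>
  A vertex of a PBR on \<open>(X, Y)\<close> is \<open>Inl x\<close>, the element \<open>x\<close> seen in the domain \<open>X\<close>, or \<open>Inr y\<close>, the
  element \<open>y\<close> seen in the codomain \<open>Y\<close>.
\<close>

type_synonym ('a, 'b) pbr = "(('a + 'b) \<times> ('a + 'b)) set"

definition pbrs :: "'a set \<Rightarrow> 'b set \<Rightarrow> ('a, 'b) pbr set" where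
  "pbrs X Y = Pow ((X <+> Y) \<times> (X <+> Y))"

text \<open>
  The disjoint union of \<open>X\<close>, \<open>Y\<close> and \<open>Z\<close> lives in the type \<open>'a + 'b + 'c\<close>, that is, \<open>'a + ('b + 'c)\<close>;
  the following maps embed the disjoint unions of two of the three sets.
\<close>

definition emb12 :: "'a + 'b \<Rightarrow> 'a + 'b + 'c" where
  "emb12 = case_sum Inl (\<lambda>y. Inr (Inl y))"

definition emb23 :: "'b + 'c \<Rightarrow> 'a + 'b + 'c" where
  "emb23 = case_sum (\<lambda>y. Inr (Inl y)) (\<lambda>z. Inr (Inr z))"

definition emb13 :: "'a + 'c \<Rightarrow> 'a + 'b + 'c" where
  "emb13 = case_sum Inl (\<lambda>z. Inr (Inr z))"

text \<open>
  Each edge of a connected sequence carries a tag recording the PBR it is taken from, because the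
  same pair of elements of \<open>Y\<close> may be an edge of both.
\<close>

datatype origin = From_fst | From_snd

definition connected_seq ::
    "('a, 'b) pbr \<Rightarrow> ('b, 'c) pbr \<Rightarrow> (origin \<times> ('a + 'b + 'c) \<times> ('a + 'b + 'c)) list \<Rightarrow> bool" where
  "connected_seq \<alpha> \<beta> s \<longleftrightarrow>
    s \<noteq> [] \<and>
    set s \<subseteq> {From_fst} \<times> map_prod emb12 emb12 ` \<alpha> \<union> {From_snd} \<times> map_prod emb23 emb23 ` \<beta> \<and>
    successively (\<lambda>(t, a, b) (t', a', b'). t \<noteq> t' \<and> b = a') s"

definition connects :: "('t \<times> 'v \<times> 'v) list \<Rightarrow> 'v \<Rightarrow> 'v \<Rightarrow> bool" where
  "connects s u v \<longleftrightarrow> fst (snd (hd s)) = u \<and> snd (snd (last s)) = v"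

definition pbr_comp :: "('b, 'c) pbr \<Rightarrow> ('a, 'b) pbr \<Rightarrow> ('a, 'c) pbr" where
  "pbr_comp \<beta> \<alpha> = {(a, b). \<exists>s. connected_seq \<alpha> \<beta> s \<and> connects s (emb13 a) (emb13 b)}"

definition pbr_id :: "'a set \<Rightarrow> ('a, 'a) pbr" where
  "pbr_id X = {(Inl x, Inr x) | x. x \<in> X} \<union> {(Inr x, Inl x) | x. x \<in> X}"

definition pbr_cat :: "('a set, ('a, 'a) pbr) cat" where
  "pbr_cat =
    \<lparr>obj = {X. finite X},
     hom = pbrs,
     comp = (\<lambda>X Y Z. pbr_comp),
     idn = pbr_id\<rparr>"

text \<open>
  The maps \<open>i\<close> and \<open>j\<close> tell how source and target of the relation sit in the disjoint union: for
  \<open>\<theta>\<close> the source is the domain of the PBR, for its converse the source is the codomain.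
\<close>

definition Phi1 :: "('s \<Rightarrow> 'v) \<Rightarrow> ('t \<Rightarrow> 'v) \<Rightarrow> ('s \<times> 't) set \<Rightarrow> ('v \<times> 'v) set" where
  "Phi1 i j \<theta> = map_prod i j ` \<theta>"

definition Phi2 :: "('a \<times> 'b) set \<Rightarrow> ('a, 'b) pbr" where
  "Phi2 \<theta> = Phi1 Inl Inr \<theta> \<union> Phi1 Inr Inl (\<theta>\<inverse>)"

end

theory Submission
  imports Defs
begin

text \<open>
  A connected sequence is a walk whose edges carry tags, with consecutive tags distinct. The whole
  development rests on this view, captured inductively by \<open>alternates\<close> for any family of edge
  relations indexed by tags.

  Functoriality is then short. The edges of \<open>Phi2 \<theta>\<close> all run between \<open>X\<close> and \<open>Y\<close>, and those of
  \<open>Phi2 \<eta>\<close> between \<open>Y\<close> and \<open>Z\<close>. An alternating walk that starts in \<open>X\<close> crosses to \<open>Y\<close> and then to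
  \<open>Z\<close>, where it is stuck, as the next edge would have to belong to \<open>Phi2 \<theta>\<close>; walks that start
  in \<open>Z\<close> behave symmetrically. The walks with both ends in the disjoint union of \<open>X\<close> and \<open>Z\<close> thus
  have exactly two edges and compute the relational product and its converse
  (\<open>Phi2_relcomp\<close>). Faithfulness holds because \<open>\<theta>\<close> is read off from the edges of \<open>Phi2 \<theta>\<close> that
  lead from the domain to the codomain.

  The substantial part is that PBRs form a category, and there associativity. Both bracketings of
  \<open>\<gamma> \<circ> \<beta> \<circ> \<alpha>\<close> are compared with the alternating walks on \<open>W\<close>, \<open>X\<close>, \<open>Y\<close>, \<open>Z\<close> that use three tags,
  one for each of \<open>\<alpha>\<close>, \<open>\<beta>\<close>, \<open>\<gamma>\<close>. Any such walk is cut at its \<open>\<gamma>\<close>-edges. A maximal piece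
  between them is a walk in \<open>\<alpha>\<close> and \<open>\<beta>\<close>; if the whole walk has its ends outside \<open>X\<close>, then so does
  the piece, since \<open>\<gamma>\<close> does not touch \<open>X\<close>, and the piece is one edge of \<open>\<beta> \<circ> \<alpha>\<close>. Conversely,
  substituting pieces for the edges of \<open>\<beta> \<circ> \<alpha>\<close> keeps consecutive tags distinct. This argument
  (\<open>linked_nested_iff\<close>) singles out one tag, and the other bracketing is the same argument with
  \<open>\<alpha>\<close> singled out. To have all compositions happen among the same vertices, they are first
  transported along injections into one ambient type (\<open>edges_in_pbr_comp\<close>).

  The left identity law is an invariant of walks; the right one follows by exchanging the roles of
  domain and codomain.
\<close>

section \<open>Alternating walks\<close>

text \<open>
  The walk leads from \<open>u\<close> to \<open>v\<close>, and its first and last edges have the tags \<open>s\<close> and \<open>t\<close>. Recording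
  the last tag is what makes extension by an edge possible, recording the first one makes
  concatenation possible.
\<close>

inductive alternates :: "('t \<Rightarrow> ('v \<times> 'v) set) \<Rightarrow> 'v \<Rightarrow> 't \<Rightarrow> 't \<Rightarrow> 'v \<Rightarrow> bool"
  for E where
    edge: "(u, v) \<in> E t \<Longrightarrow> alternates E u t t v"
  | snoc: "alternates E u s t v \<Longrightarrow> (v, w) \<in> E t' \<Longrightarrow> t \<noteq> t' \<Longrightarrow> alternates E u s t' w"

definition linked :: "('t \<Rightarrow> ('v \<times> 'v) set) \<Rightarrow> 'v \<Rightarrow> 'v \<Rightarrow> bool" where
  "linked E u v \<longleftrightarrow> (\<exists>s t. alternates E u s t v)"

lemma alternates_trans:
  assumes "alternates E v s' t' w" and "alternates E u s t v" and "t \<noteq> s'"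
  shows "alternates E u s t' w"
  using assms by (induction rule: alternates.induct) (auto intro: alternates.intros)

lemma alternates_ends:
  assumes "alternates E u s t v"
  shows "u \<in> Domain (E s)" and "v \<in> Range (E t)"
  using assms by (induction rule: alternates.induct) auto

lemma alternates_if_sequence:
  assumes "s \<noteq> []" and "\<forall>(t, e) \<in> set s. e \<in> E t"
    and "successively (\<lambda>(t, a, b) (t', a', b'). t \<noteq> t' \<and> b = a') s"
  shows "alternates E (fst (snd (hd s))) (fst (hd s)) (fst (last s)) (snd (snd (last s)))"
  using assms
proof (induction s rule: rev_nonempty_induct)
  case (single x)
  then show ?case by (cases x) (auto intro: alternates.edge)
next
  case (snoc x xs)
  obtain t a b where x: "x = (t, a, b)" by (cases x)
  obtain t' a' b' where l: "last xs = (t', a', b')" by (cases "last xs")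
  have "t' \<noteq> t" "b' = a" "(a, b) \<in> E t"
    using snoc.prems snoc.hyps x l by (auto simp: successively_append_iff)
  moreover have "alternates E (fst (snd (hd xs))) (fst (hd xs)) t' b'"
    using snoc l by (simp add: successively_append_iff)
  ultimately show ?case
    using snoc.hyps x by (auto intro: alternates.snoc)
qed

lemma sequence_if_alternates:
  assumes "alternates E u t0 t v"
  shows "\<exists>s. s \<noteq> [] \<and> (\<forall>(t, e) \<in> set s. e \<in> E t) \<and>
    successively (\<lambda>(t, a, b) (t', a', b'). t \<noteq> t' \<and> b = a') s \<and>
    connects s u v \<and> fst (last s) = t"
  using assms
proof (induction rule: alternates.induct)
  case (edge u v t)
  then show ?case by (intro exI[of _ "[(t, u, v)]"]) (auto simp: connects_def)
next
  case (snoc u t0 t v w t')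
  then obtain s where "s \<noteq> []" "\<forall>(t, e) \<in> set s. e \<in> E t"
    "successively (\<lambda>(t, a, b) (t', a', b'). t \<noteq> t' \<and> b = a') s" "connects s u v" "fst (last s) = t"
    by blast
  with snoc.hyps show ?case
    by (intro exI[of _ "s @ [(t', v, w)]"])
      (auto simp: connects_def successively_append_iff split: prod.splits)
qed

lemma pbr_comp_iff_linked:
  "(a, b) \<in> pbr_comp \<beta> \<alpha> \<longleftrightarrow>
    linked (case_origin (map_prod emb12 emb12 ` \<alpha>) (map_prod emb23 emb23 ` \<beta>)) (emb13 a) (emb13 b)"
  (is "_ \<longleftrightarrow> linked ?E _ _")
proof -
  have "set s \<subseteq> {From_fst} \<times> map_prod emb12 emb12 ` \<alpha> \<union> {From_snd} \<times> map_prod emb23 emb23 ` \<beta> \<longleftrightarrow>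
    (\<forall>(t, e) \<in> set s. e \<in> ?E t)" for s
    by (fastforce split: origin.splits)
  then have comp: "(a, b) \<in> pbr_comp \<beta> \<alpha> \<longleftrightarrow> (\<exists>s. s \<noteq> [] \<and> (\<forall>(t, e) \<in> set s. e \<in> ?E t) \<and>
    successively (\<lambda>(t, a, b) (t', a', b'). t \<noteq> t' \<and> b = a') s \<and> connects s (emb13 a) (emb13 b))"
    by (simp add: pbr_comp_def connected_seq_def)
  show ?thesis
  proof
    assume "(a, b) \<in> pbr_comp \<beta> \<alpha>"
    then obtain s where "s \<noteq> []" "\<forall>(t, e) \<in> set s. e \<in> ?E t"
      "successively (\<lambda>(t, a, b) (t', a', b'). t \<noteq> t' \<and> b = a') s" and "connects s (emb13 a) (emb13 b)"
      unfolding comp by blast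
    then show "linked ?E (emb13 a) (emb13 b)"
      using alternates_if_sequence[of s ?E] unfolding linked_def connects_def by auto
  next
    assume "linked ?E (emb13 a) (emb13 b)"
    then show "(a, b) \<in> pbr_comp \<beta> \<alpha>"
      unfolding linked_def comp by (blast dest: sequence_if_alternates)
  qed
qed

section \<open>Composition inside an ambient set of vertices\<close>

text \<open>
  A tag outside the range of \<open>g\<close> has no edges, so a walk never uses it. This lets a system with two
  tags be compared with a system with three tags one of which has been emptied.
\<close>

lemma alternates_image_iff:
  assumes "inj h" and "inj g"
    and E': "\<And>t. E' (g t) = map_prod h h ` E t" and empty: "\<And>t. t \<notin> range g \<Longrightarrow> E' t = {}"
  shows "alternates E' x s' t' y \<longleftrightarrow>
    (\<exists>u s t v. x = h u \<and> s' = g s \<and> t' = g t \<and> y = h v \<and> alternates E u s t v)"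
proof
  assume "alternates E' x s' t' y"
  then show "\<exists>u s t v. x = h u \<and> s' = g s \<and> t' = g t \<and> y = h v \<and> alternates E u s t v"
  proof (induction rule: alternates.induct)
    case (edge u v t)
    then obtain k where "t = g k" using empty by blast
    moreover from this edge E' obtain u0 v0 where "u = h u0" "v = h v0" "(u0, v0) \<in> E k" by auto
    ultimately show ?case by (metis alternates.edge)
  next
    case (snoc u s t v w t')
    then obtain k where k: "t' = g k" using empty by blast
    obtain u0 s0 t0 v0 where 0: "u = h u0" "s = g s0" "t = g t0" "v = h v0" "alternates E u0 s0 t0 v0"
      using snoc.IH by blast
    obtain w0 where "w = h w0" "(v0, w0) \<in> E k"
      using snoc.hyps(2) k E' 0(4) \<open>inj h\<close> by (auto dest: injD)
    with 0 k snoc.hyps(3) show ?case by (metis alternates.snoc)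
  qed
next
  have "alternates E' (h u) (g s) (g t) (h v)" if "alternates E u s t v" for u s t v
    using that
  proof (induction rule: alternates.induct)
    case (edge u v t)
    then show ?case by (intro alternates.edge) (auto simp: E')
  next
    case (snoc u s t v w t')
    then show ?case
      by (intro alternates.snoc[OF snoc.IH, of _ "g t'"]) (auto simp: E' dest: injD[OF \<open>inj g\<close>])
  qed
  then show "alternates E' x s' t' y"
    if "\<exists>u s t v. x = h u \<and> s' = g s \<and> t' = g t \<and> y = h v \<and> alternates E u s t v"
    using that by blast
qed

lemma linked_image_iff:
  assumes "inj h" and "inj g"
    and "\<And>t. E' (g t) = map_prod h h ` E t" and "\<And>t. t \<notin> range g \<Longrightarrow> E' t = {}"
  shows "linked E' x y \<longleftrightarrow> (\<exists>u v. x = h u \<and> y = h v \<and> linked E u v)"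
proof -
  have "alternates E' x s' t' y \<longleftrightarrow>
    (\<exists>u s t v. x = h u \<and> s' = g s \<and> t' = g t \<and> y = h v \<and> alternates E u s t v)" for s' t'
    using assms by (rule alternates_image_iff)
  then show ?thesis unfolding linked_def by blast
qed

text \<open>
  The vertex sets of successive composites live in different sum types. Viewing all PBRs as
  relations on one type \<open>'v\<close>, by injections of their vertices, makes composites comparable.
\<close>

definition edges_in :: "('a \<Rightarrow> 'v) \<Rightarrow> ('b \<Rightarrow> 'v) \<Rightarrow> ('a, 'b) pbr \<Rightarrow> ('v \<times> 'v) set" where
  "edges_in f g \<alpha> = map_prod (case_sum f g) (case_sum f g) ` \<alpha>"

lemma inj_case_origin: "inj (case_origin p q) \<longleftrightarrow> p \<noteq> q"
  by (auto simp: inj_def split: origin.splits)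

lemma range_case_origin: "range (case_origin p q) = {p, q}"
  by (auto simp: image_iff split: origin.splits intro: exI[of _ From_fst] exI[of _ From_snd])

lemma edges_in_inject:
  assumes "inj (case_sum f g)"
  shows "edges_in f g \<alpha> = edges_in f g \<beta> \<longleftrightarrow> \<alpha> = \<beta>"
  unfolding edges_in_def using prod.inj_map[OF assms assms] by (rule inj_image_eq_iff)

text \<open>
  Composition does not depend on where the disjoint union is realised: jointly injective maps
  \<open>f\<close>, \<open>g\<close>, \<open>h\<close> transport walks faithfully, even if \<open>'v\<close> contains further vertices, because walks
  stay on the vertices of edges. Excluding the range of \<open>g\<close> then says that the ends lie in the
  domain or codomain of the composite. The family \<open>E\<close> may have spare tags as long as they carry
  no edges.
\<close>

lemma edges_in_pbr_comp:
  fixes tag :: "origin \<Rightarrow> 't"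
  assumes inj: "inj (case_sum f (case_sum g h))" and "inj tag"
    and E: "E (tag From_fst) = edges_in f g \<alpha>" "E (tag From_snd) = edges_in g h \<beta>"
    and empty: "\<And>t. t \<notin> range tag \<Longrightarrow> E t = {}"
  shows "edges_in f h (pbr_comp \<beta> \<alpha>) = {(u, v). u \<notin> range g \<and> v \<notin> range g \<and> linked E u v}"
proof -
  let ?E = "case_origin (map_prod emb12 emb12 ` \<alpha>) (map_prod emb23 emb23 ` \<beta>)"
  let ?k = "case_sum f (case_sum g h)"
  have emb: "?k \<circ> emb12 = case_sum f g" "?k \<circ> emb23 = case_sum g h" "?k \<circ> emb13 = case_sum f h"
    by (auto simp: emb12_def emb23_def emb13_def fun_eq_iff split: sum.splits)
  have "E (tag t) = map_prod ?k ?k ` ?E t" for t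
    using E emb by (cases t) (auto simp: edges_in_def image_image prod.map_comp)
  then have linked: "linked E x y \<longleftrightarrow> (\<exists>u v. x = ?k u \<and> y = ?k v \<and> linked ?E u v)" for x y
    using linked_image_iff[OF inj \<open>inj tag\<close>, of E ?E] empty by blast
  have mid: "?k u \<notin> range g \<longleftrightarrow> (\<exists>a. u = emb13 a)" for u
  proof -
    have "f x \<noteq> g y" "h z \<noteq> g y" for x y z
      using injD[OF inj, of "Inl x" "Inr (Inl y)"] injD[OF inj, of "Inr (Inr z)" "Inr (Inl y)"] by auto
    then show ?thesis
      by (cases u rule: sum.exhaust[case_product sum.exhaust])
        (auto simp: emb13_def split: sum.splits intro: exI[of _ "Inl _"] exI[of _ "Inr _"])
  qed
  have k: "?k (emb13 a) = case_sum f h a" for a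
    using emb(3) by (metis comp_apply)
  show ?thesis
  proof (intro set_eqI, clarify)
    fix x y
    have "(x, y) \<in> edges_in f h (pbr_comp \<beta> \<alpha>) \<longleftrightarrow>
      (\<exists>a b. x = ?k (emb13 a) \<and> y = ?k (emb13 b) \<and> linked ?E (emb13 a) (emb13 b))"
      unfolding edges_in_def k by (auto simp: pbr_comp_iff_linked[symmetric])
    also have "\<dots> \<longleftrightarrow> x \<notin> range g \<and> y \<notin> range g \<and> linked E x y"
      unfolding linked using mid by metis
    finally show "(x, y) \<in> edges_in f h (pbr_comp \<beta> \<alpha>) \<longleftrightarrow>
      (x, y) \<in> {(u, v). u \<notin> range g \<and> v \<notin> range g \<and> linked E u v}" by simp
  qed
qed

section \<open>Associativity\<close>

text \<open>
  The two-tag system \<open>N\<close> arises from \<open>E\<close> by keeping the edges tagged \<open>c\<close> and bundling each walk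
  without \<open>c\<close> whose ends avoid \<open>Y\<close> into a single edge. Refining a bundled edge leaves consecutive
  tags distinct, as neighbours of a bundled edge are tagged \<open>c\<close>. In the other direction, if a walk in
  \<open>E\<close> has its ends outside \<open>Y\<close>, then its maximal pieces without \<open>c\<close> begin and end at the ends of
  the walk or at ends of \<open>c\<close>-edges, hence outside \<open>Y\<close>.
\<close>

lemma linked_nested_iff:
  assumes "bundled \<noteq> lone" and [simp]: "N lone = E c"
    and [simp]: "N bundled = {(u, v). u \<notin> Y \<and> v \<notin> Y \<and> linked (E(c := {})) u v}"
    and empty: "\<And>t. t \<noteq> bundled \<Longrightarrow> t \<noteq> lone \<Longrightarrow> N t = {}"
    and c: "Field (E c) \<inter> Y = {}"
  shows "linked N u v \<longleftrightarrow> u \<notin> Y \<and> v \<notin> Y \<and> linked E u v"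
proof
  have sub: "alternates E x s t y \<and> s \<noteq> c \<and> t \<noteq> c" if "alternates (E(c := {})) x s t y" for x s t y
    using that
    by (induction rule: alternates.induct) (auto split: if_splits intro: alternates.intros)
  have "\<exists>s t. alternates E u s t v \<and> (t = c \<longleftrightarrow> k = lone)" if "alternates N u i k v" for u i k v
    using that
  proof (induction rule: alternates.induct)
    case (edge u v k)
    then consider "k = lone" "(u, v) \<in> E c" | "k = bundled" "linked (E(c := {})) u v"
      using empty by (cases "k = lone"; cases "k = bundled") auto
    then show ?case
      using sub \<open>bundled \<noteq> lone\<close> unfolding linked_def by cases (blast intro: alternates.edge)+
  next
    case (snoc u i k v w k')
    then obtain s t where st: "alternates E u s t v" "t = c \<longleftrightarrow> k = lone" by blast
    consider "k' = lone" "(v, w) \<in> E c"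
      | s' t' where "k' = bundled" "k = lone" "alternates (E(c := {})) v s' t' w"
    proof -
      have "k = lone \<or> k = bundled"
        using empty[of k] alternates_ends(2)[OF snoc.hyps(1)] by auto
      moreover have "k' = lone \<or> k' = bundled"
        using empty[of k'] snoc.hyps(2) by auto
      ultimately show thesis
        using snoc.hyps(2,3) that by (auto simp: linked_def)
    qed
    then show ?case
    proof cases
      case 1
      then show ?thesis using st snoc.hyps(3) by (blast intro: alternates.snoc)
    next
      case 2
      then show ?thesis
        using st sub[OF 2(3)] alternates_trans \<open>bundled \<noteq> lone\<close> by metis
    qed
  qed
  moreover have "Field (N k) \<inter> Y = {}" for k
    using c empty by (cases "k = lone"; cases "k = bundled") (auto simp: Field_def)
  ultimately show "u \<notin> Y \<and> v \<notin> Y \<and> linked E u v" if "linked N u v"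
    using that alternates_ends[of N u _ _ v] unfolding linked_def Field_def by blast
next
  \<comment> \<open>If the last edge is not tagged \<open>c\<close>, the walk ends within an unfinished piece, which started at
    a vertex \<open>w\<close> that is either \<open>u\<close> or the target of the latest \<open>c\<close>-edge.\<close>
  have inv: "if t = c then \<exists>i. alternates N u i lone v
    else \<exists>w s'. w \<notin> Y \<and> (w = u \<or> (\<exists>i. alternates N u i lone w)) \<and> alternates (E(c := {})) w s' t v"
    if "alternates E u s t v" "u \<notin> Y" for u s t v
    using that
  proof (induction rule: alternates.induct)
    case (edge u v t)
    show ?case
    proof (cases "t = c")
      case True
      then show ?thesis using edge alternates.edge[of u v N lone] by auto
    next
      case False
      then have "alternates (E(c := {})) u t t v"
        using edge by (intro alternates.edge) simp
      then show ?thesis using False edge by auto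
    qed
  next
    case (snoc u s t v w t')
    consider "t = c" "t' \<noteq> c" | "t \<noteq> c" "t' = c" | "t \<noteq> c" "t' \<noteq> c"
      using snoc.hyps(3) by blast
    then show ?case
    proof cases
      case 1
      then have "v \<notin> Y"
        using c alternates_ends(2)[OF snoc.hyps(1)] by (auto simp: Field_def)
      moreover have "alternates (E(c := {})) v t' t' w"
        using 1 snoc.hyps(2) by (intro alternates.edge) simp
      ultimately show ?thesis using 1 snoc by auto
    next
      case 2
      then obtain x s' where x: "x \<notin> Y" "x = u \<or> (\<exists>i. alternates N u i lone x)"
        "alternates (E(c := {})) x s' t v"
        using snoc by auto
      have "v \<notin> Y" using c snoc.hyps(2) 2 by (auto simp: Field_def)
      then have "(x, v) \<in> N bundled" using x by (auto simp: linked_def)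
      then obtain i where "alternates N u i bundled v"
        using x(2) \<open>bundled \<noteq> lone\<close> by (metis alternates.intros)
      then show ?thesis
        using 2 snoc.hyps(2) \<open>bundled \<noteq> lone\<close> alternates.snoc[of N u i bundled v w lone] by auto
    next
      case 3
      then obtain x s' where x: "x \<notin> Y" "x = u \<or> (\<exists>i. alternates N u i lone x)"
        "alternates (E(c := {})) x s' t v"
        using snoc by auto
      have "alternates (E(c := {})) x s' t' w"
        using 3 snoc.hyps by (intro alternates.snoc[OF x(3)]) auto
      then show ?thesis using 3 x by auto
    qed
  qed
  assume "u \<notin> Y \<and> v \<notin> Y \<and> linked E u v"
  then have "u \<notin> Y" "v \<notin> Y" "linked E u v" by auto
  then obtain s t where st: "alternates E u s t v" unfolding linked_def by blast
  show "linked N u v"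
  proof (cases "t = c")
    case True
    then show ?thesis using inv[OF st \<open>u \<notin> Y\<close>] unfolding linked_def by auto
  next
    case False
    then obtain x s' where x: "x \<notin> Y" "x = u \<or> (\<exists>i. alternates N u i lone x)"
      "alternates (E(c := {})) x s' t v"
      using inv[OF st \<open>u \<notin> Y\<close>] by auto
    then have "(x, v) \<in> N bundled" using \<open>v \<notin> Y\<close> by (auto simp: linked_def)
    then show ?thesis
      using x(2) \<open>bundled \<noteq> lone\<close> unfolding linked_def by (metis alternates.intros)
  qed
qed

datatype factor = F1 | F2 | F3

text \<open>
  With four vertex sets embedded in one sum, \<open>F3\<close> is singled out for one bracketing and \<open>F1\<close> for the
  other. Each yields the three-tag walks whose ends avoid both inner sets: one of these is
  excluded by the outer composition, the other by the inner one.
\<close>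

lemma pbr_comp_assoc:
  fixes \<alpha> :: "('a, 'b) pbr" and \<beta> :: "('b, 'c) pbr" and \<gamma> :: "('c, 'd) pbr"
  shows "pbr_comp (pbr_comp \<gamma> \<beta>) \<alpha> = pbr_comp \<gamma> (pbr_comp \<beta> \<alpha>)"
proof -
  define w x y z where "w = (Inl :: 'a \<Rightarrow> 'a + 'b + 'c + 'd)"
    and "x = (Inr \<circ> Inl :: 'b \<Rightarrow> 'a + 'b + 'c + 'd)"
    and "y = (Inr \<circ> Inr \<circ> Inl :: 'c \<Rightarrow> 'a + 'b + 'c + 'd)"
    and "z = (Inr \<circ> Inr \<circ> Inr :: 'd \<Rightarrow> 'a + 'b + 'c + 'd)"
  note incl = w_def x_def y_def z_def
  define E where "E = case_factor (edges_in w x \<alpha>) (edges_in x y \<beta>) (edges_in y z \<gamma>)"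
  have E_simps: "E F1 = edges_in w x \<alpha>" "E F2 = edges_in x y \<beta>" "E F3 = edges_in y z \<gamma>"
    by (simp_all add: E_def)
  have inj: "inj (case_sum w (case_sum x y))" "inj (case_sum x (case_sum y z))"
    "inj (case_sum w (case_sum y z))" "inj (case_sum w (case_sum x z))"
    by (auto simp: incl inj_def split: sum.splits)
  have avoid: "Field (E F3) \<inter> range x = {}" "Field (E F1) \<inter> range y = {}"
    by (auto simp: E_simps edges_in_def incl Field_def split: sum.splits)

  define N where "N = case_origin (edges_in w y (pbr_comp \<beta> \<alpha>)) (edges_in y z \<gamma>)"
  define N' where "N' = case_origin (edges_in w x \<alpha>) (edges_in x z (pbr_comp \<gamma> \<beta>))"
  have factors: "t = F1 \<or> t = F2 \<or> t = F3" for t by (cases t) auto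
  have origins: "t \<noteq> From_fst \<longleftrightarrow> t = From_snd" for t by (cases t) auto
  have "N From_fst = {(u, v). u \<notin> range x \<and> v \<notin> range x \<and> linked (E(F3 := {})) u v}"
    unfolding N_def origin.case
    by (rule edges_in_pbr_comp[OF inj(1), of "case_origin F1 F2"])
      (use factors in \<open>auto simp: E_simps inj_case_origin range_case_origin\<close>)
  moreover have "N From_snd = E F3" by (simp add: N_def E_simps)
  ultimately have linked_N: "linked N u v \<longleftrightarrow> u \<notin> range x \<and> v \<notin> range x \<and> linked E u v" for u v
    by (intro linked_nested_iff[of From_fst From_snd]) (use avoid in \<open>auto simp: origins\<close>)
  have "N' From_snd = {(u, v). u \<notin> range y \<and> v \<notin> range y \<and> linked (E(F1 := {})) u v}"
    unfolding N'_def origin.case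
    by (rule edges_in_pbr_comp[OF inj(2), of "case_origin F2 F3"])
      (use factors in \<open>auto simp: E_simps inj_case_origin range_case_origin\<close>)
  moreover have "N' From_fst = E F1" by (simp add: N'_def E_simps)
  ultimately have linked_N': "linked N' u v \<longleftrightarrow> u \<notin> range y \<and> v \<notin> range y \<and> linked E u v" for u v
    by (intro linked_nested_iff[of From_snd From_fst]) (use avoid in \<open>auto simp: origins\<close>)

  have "edges_in w z (pbr_comp \<gamma> (pbr_comp \<beta> \<alpha>)) =
      {(u, v). u \<notin> range y \<and> v \<notin> range y \<and> linked N u v}"
    by (rule edges_in_pbr_comp[OF inj(3), of id]) (auto simp: N_def)
  also have "\<dots> = {(u, v). u \<notin> range x \<and> v \<notin> range x \<and> linked N' u v}"
    by (auto simp: linked_N linked_N')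
  also have "\<dots> = edges_in w z (pbr_comp (pbr_comp \<gamma> \<beta>) \<alpha>)"
    by (rule edges_in_pbr_comp[OF inj(4), of id, symmetric]) (auto simp: N'_def)
  finally have "edges_in w z (pbr_comp \<gamma> (pbr_comp \<beta> \<alpha>)) = edges_in w z (pbr_comp (pbr_comp \<gamma> \<beta>) \<alpha>)" .
  moreover have "inj (case_sum w z)"
    by (auto simp: incl inj_def split: sum.splits)
  ultimately show ?thesis
    using edges_in_inject by metis
qed

section \<open>Identity laws and the category of PBRs\<close>

lemma emb_simps [simp]:
  "emb12 (Inl x) = Inl x" "emb12 (Inr y) = Inr (Inl y)"
  "emb23 (Inl y) = Inr (Inl y)" "emb23 (Inr z) = Inr (Inr z)"
  "emb13 (Inl x) = Inl x" "emb13 (Inr z) = Inr (Inr z)"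
  by (simp_all add: emb12_def emb23_def emb13_def)

lemma emb_eq_simps [simp]:
  "emb12 p = Inl x \<longleftrightarrow> p = Inl x" "emb12 p = Inr (Inl y) \<longleftrightarrow> p = Inr y" "emb12 p \<noteq> Inr (Inr z)"
  "emb23 q \<noteq> Inl x" "emb23 q = Inr (Inl y) \<longleftrightarrow> q = Inl y" "emb23 q = Inr (Inr z) \<longleftrightarrow> q = Inr z"
  "emb13 r = Inl x \<longleftrightarrow> r = Inl x" "emb13 r \<noteq> Inr (Inl y)" "emb13 r = Inr (Inr z) \<longleftrightarrow> r = Inr z"
  by (auto simp: emb12_def emb23_def emb13_def split: sum.splits)

text \<open>
  An identity edge only exchanges the two copies of some \<open>y \<in> Y\<close>. A walk that begins in the outer
  copy must enter the inner one first, and one that returns to the outer copy after an edge of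
  \<open>\<alpha>\<close> cannot go on, so exactly one edge of \<open>\<alpha>\<close> is used.
\<close>

lemma pbr_comp_pbr_id_left:
  assumes "\<alpha> \<in> pbrs X Y"
  shows "pbr_comp (pbr_id Y) \<alpha> = \<alpha>"
proof -
  define E where "E = case_origin (map_prod emb12 emb12 ` \<alpha>)
    (map_prod emb23 emb23 ` pbr_id Y :: (('a + 'b + 'b) \<times> _) set)"
  have fst_iff: "(u, v) \<in> E From_fst \<longleftrightarrow> (\<exists>(p, q) \<in> \<alpha>. u = emb12 p \<and> v = emb12 q)" for u v
    by (auto simp: E_def)
  have snd_iff: "(u, v) \<in> E From_snd \<longleftrightarrow>
    (\<exists>y\<in>Y. u = Inr (Inl y) \<and> v = Inr (Inr y) \<or> u = Inr (Inr y) \<and> v = Inr (Inl y))" for u v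
    by (force simp: E_def pbr_id_def)
  have Y: "y \<in> Y" if "(Inr y, q) \<in> \<alpha> \<or> (q, Inr y) \<in> \<alpha>" for y q
    using that assms by (auto simp: pbrs_def)
  \<comment> \<open>After an identity edge, the walk is either at the inner copy, having used no edge of \<open>\<alpha>\<close> yet,
    or at the outer copy, having used the edge \<open>(a, Inr y)\<close>.\<close>
  have inv: "case t of From_fst \<Rightarrow> \<exists>q. v = emb12 q \<and> (a, q) \<in> \<alpha>
      | From_snd \<Rightarrow> \<exists>y. v = Inr (Inl y) \<and> a = Inr y \<or> v = Inr (Inr y) \<and> (a, Inr y) \<in> \<alpha>"
    if "alternates E (emb13 a) s t v" for a s t v
    using that
  proof (induction "emb13 a :: 'a + 'b + 'b" s t v rule: alternates.induct)
    case (edge v t)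
    then show ?case
      by (cases t; cases a) (auto simp: fst_iff snd_iff eq_commute[of "Inl _" "emb12 _"] eq_commute[of "Inr _" "emb12 _"])
  next
    case (snoc s t v w t')
    then show ?case
      by (cases t; cases t') (auto simp: fst_iff snd_iff eq_commute[of "Inr _" "emb12 _"])
  qed
  have "(a, b) \<in> \<alpha>" if ab: "linked E (emb13 a) (emb13 b)" for a b
  proof -
    obtain s t where "alternates E (emb13 a) s t (emb13 b)"
      using ab unfolding linked_def by blast
    from inv[OF this] show ?thesis
      by (cases t; cases b) (auto simp: eq_commute[of "Inl _" "emb12 _"] eq_commute[of "Inr _" "emb12 _"])
  qed
  moreover have "linked E (emb13 a) (emb13 b)" if ab: "(a, b) \<in> \<alpha>" for a b
  proof -
    have "\<exists>s. alternates E (emb13 a) s From_fst (emb12 b)"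
    proof (cases a)
      case (Inl x)
      then have "(emb13 a, emb12 b) \<in> E From_fst"
        using ab by (force simp: fst_iff)
      then show ?thesis by (blast intro: alternates.edge)
    next
      case (Inr y)
      then have "alternates E (emb13 a) From_snd From_snd (Inr (Inl y))"
        using Y ab by (intro alternates.edge) (auto simp: snd_iff)
      moreover have "(Inr (Inl y), emb12 b) \<in> E From_fst"
        using Inr ab by (force simp: fst_iff)
      ultimately show ?thesis by (blast intro: alternates.snoc)
    qed
    then obtain s where s: "alternates E (emb13 a) s From_fst (emb12 b)" ..
    show ?thesis
    proof (cases b)
      case (Inl x)
      then show ?thesis using s unfolding linked_def by auto
    next
      case (Inr y)
      then have "(emb12 b, emb13 b) \<in> E From_snd"
        using Y ab by (auto simp: snd_iff)
      then show ?thesis using alternates.snoc[OF s] unfolding linked_def by blast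
    qed
  qed
  ultimately show ?thesis
    by (intro set_eqI) (auto simp: pbr_comp_iff_linked E_def)
qed

text \<open>
  Exchanging domain and codomain reverses the order of composition and fixes identities, so it
  turns the left identity law into the right one.
\<close>

definition mirror :: "('a, 'b) pbr \<Rightarrow> ('b, 'a) pbr" where
  "mirror \<alpha> = edges_in Inr Inl \<alpha>"

lemma mirror_inject: "mirror \<alpha> = mirror \<beta> \<longleftrightarrow> \<alpha> = \<beta>"
  unfolding mirror_def by (rule edges_in_inject) (auto simp: inj_def split: sum.splits)

lemma edges_in_mirror: "edges_in g f (mirror \<alpha>) = edges_in f g \<alpha>"
proof -
  have "case_sum g f \<circ> case_sum Inr Inl = case_sum f g"
    by (auto simp: fun_eq_iff split: sum.splits)
  then show ?thesis
    by (simp add: mirror_def edges_in_def image_comp map_prod.comp)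
qed

text \<open>
  Both sides consist of the same walks in an ambient sum: the maps \<open>f\<close>, \<open>h\<close> of
  \<open>edges_in_pbr_comp\<close> and the two tags trade places.
\<close>

lemma mirror_pbr_comp:
  "mirror (pbr_comp \<beta> \<alpha>) = pbr_comp (mirror \<alpha>) (mirror \<beta>)"
proof -
  define E where "E = case_origin (edges_in Inl (Inr \<circ> Inl) \<alpha>) (edges_in (Inr \<circ> Inl) (Inr \<circ> Inr) \<beta>)"
  have "edges_in (Inr \<circ> Inr) Inl (mirror (pbr_comp \<beta> \<alpha>)) =
      {(u, v). u \<notin> range (Inr \<circ> Inl) \<and> v \<notin> range (Inr \<circ> Inl) \<and> linked E u v}"
    unfolding edges_in_mirror
    by (rule edges_in_pbr_comp[of _ _ _ id]) (auto simp: inj_def E_def split: sum.splits)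
  also have "\<dots> = edges_in (Inr \<circ> Inr) Inl (pbr_comp (mirror \<alpha>) (mirror \<beta>))"
    by (rule edges_in_pbr_comp[of _ _ _ "case_origin From_snd From_fst", symmetric])
      (auto simp: inj_case_origin range_case_origin E_def edges_in_mirror inj_def split: sum.splits origin.splits)
  finally show ?thesis
    by (subst (asm) edges_in_inject) (auto simp: inj_def split: sum.splits)
qed

lemma pbr_comp_pbr_id_right:
  assumes "\<alpha> \<in> pbrs X Y"
  shows "pbr_comp \<alpha> (pbr_id X) = \<alpha>"
proof -
  have "mirror \<alpha> \<in> pbrs Y X"
    using assms by (force simp: mirror_def edges_in_def pbrs_def)
  moreover have "mirror (pbr_id X) = pbr_id X"
    by (force simp: mirror_def edges_in_def pbr_id_def)
  ultimately have "mirror (pbr_comp \<alpha> (pbr_id X)) = mirror \<alpha>"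
    by (simp add: mirror_pbr_comp pbr_comp_pbr_id_left)
  then show ?thesis by (simp add: mirror_inject)
qed

lemma pbr_comp_closed:
  assumes "\<alpha> \<in> pbrs X Y" "\<beta> \<in> pbrs Y Z"
  shows "pbr_comp \<beta> \<alpha> \<in> pbrs X Z"
proof -
  let ?E = "case_origin (map_prod emb12 emb12 ` \<alpha>) (map_prod emb23 emb23 ` \<beta>)"
  have end_in: "a \<in> X <+> Z" if "emb13 a \<in> Field (?E t)" for a t
    using that assms
    by (cases t; cases a) (auto simp: Field_def pbrs_def emb12_def emb23_def split: sum.splits)
  have "a \<in> X <+> Z \<and> b \<in> X <+> Z" if "(a, b) \<in> pbr_comp \<beta> \<alpha>" for a b
  proof -
    obtain s t where "alternates ?E (emb13 a) s t (emb13 b)"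
      using \<open>(a, b) \<in> pbr_comp \<beta> \<alpha>\<close> unfolding pbr_comp_iff_linked linked_def by blast
    from alternates_ends[OF this] show ?thesis
      using end_in unfolding Field_def by blast
  qed
  then show ?thesis by (auto simp: pbrs_def)
qed

lemma category_pbr_cat: "category pbr_cat"
  by unfold_locales
    (auto simp: pbr_cat_def pbr_comp_closed pbr_comp_pbr_id_left pbr_comp_pbr_id_right pbr_comp_assoc,
      auto simp: pbr_id_def pbrs_def)

lemma category_rel_cat: "category rel_cat"
  by unfold_locales (auto simp: rel_cat_def Id_on_def)

section \<open>The functor\<close>

lemma Phi2_simps [simp]:
  "(Inl x, Inr y) \<in> Phi2 \<theta> \<longleftrightarrow> (x, y) \<in> \<theta>" "(Inr y, Inl x) \<in> Phi2 \<theta> \<longleftrightarrow> (x, y) \<in> \<theta>"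
  "(Inl x, Inl x') \<notin> Phi2 \<theta>" "(Inr y, Inr y') \<notin> Phi2 \<theta>"
  by (auto simp: Phi2_def Phi1_def)

lemma Phi2_inject: "Phi2 \<theta> = Phi2 \<eta> \<longleftrightarrow> \<theta> = \<eta>"
  by (metis Phi2_simps(1) subrelI subset_antisym)

text \<open>
  A walk starting outside \<open>Y\<close> either has just entered \<open>Y\<close> by its first edge or has just crossed to
  the far side by its second; there no edge of the other PBR starts.
\<close>

lemma Phi2_relcomp:
  fixes \<theta> :: "('a \<times> 'b) set" and \<eta> :: "('b \<times> 'c) set"
  shows "Phi2 (\<theta> O \<eta>) = pbr_comp (Phi2 \<eta>) (Phi2 \<theta>)"
proof -
  define E where "E = case_origin (map_prod emb12 emb12 ` Phi2 \<theta>) (map_prod emb23 emb23 ` Phi2 \<eta>)"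
  have fst_iff: "(u, v) \<in> E From_fst \<longleftrightarrow>
    (\<exists>(x, y) \<in> \<theta>. u = Inl x \<and> v = Inr (Inl y) \<or> u = Inr (Inl y) \<and> v = Inl x)" for u v
    by (force simp: E_def Phi2_def Phi1_def)
  have snd_iff: "(u, v) \<in> E From_snd \<longleftrightarrow>
    (\<exists>(y, z) \<in> \<eta>. u = Inr (Inl y) \<and> v = Inr (Inr z) \<or> u = Inr (Inr z) \<and> v = Inr (Inl y))" for u v
    by (force simp: E_def Phi2_def Phi1_def)
  have inv: "case a of
      Inl x \<Rightarrow> t = From_fst \<and> (\<exists>y. v = Inr (Inl y) \<and> (x, y) \<in> \<theta>) \<or>
        t = From_snd \<and> (\<exists>z. v = Inr (Inr z) \<and> (x, z) \<in> \<theta> O \<eta>)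
    | Inr z \<Rightarrow> t = From_snd \<and> (\<exists>y. v = Inr (Inl y) \<and> (y, z) \<in> \<eta>) \<or>
        t = From_fst \<and> (\<exists>x. v = Inl x \<and> (x, z) \<in> \<theta> O \<eta>)"
    if "alternates E (emb13 a) s t v" for a s t v
    using that
  proof (induction "emb13 a :: 'a + 'b + 'c" s t v rule: alternates.induct)
    case (edge v t)
    then show ?case by (cases t; cases a) (auto simp: fst_iff snd_iff)
  next
    case (snoc s t v w t')
    then show ?case by (cases t'; cases a) (auto simp: fst_iff snd_iff)
  qed
  have "(a, b) \<in> Phi2 (\<theta> O \<eta>)" if "linked E (emb13 a) (emb13 b)" for a b
    using that inv[of a _ _ "emb13 b"] unfolding linked_def
    by (cases a; cases b) auto
  moreover have "linked E (emb13 a) (emb13 b)" if ab: "(a, b) \<in> Phi2 (\<theta> O \<eta>)" for a b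
  proof -
    consider x z where "a = Inl x" "b = Inr z" "(x, z) \<in> \<theta> O \<eta>"
      | x z where "a = Inr z" "b = Inl x" "(x, z) \<in> \<theta> O \<eta>"
      using ab by (cases a; cases b) auto
    then show ?thesis
    proof cases
      case 1
      then obtain y where "(x, y) \<in> \<theta>" "(y, z) \<in> \<eta>" by blast
      then have "alternates E (emb13 a) From_fst From_snd (emb13 b)"
        using 1 by (intro alternates.snoc[OF alternates.edge[of _ "Inr (Inl y)"]])
          (auto simp: fst_iff snd_iff)
      then show ?thesis unfolding linked_def by blast
    next
      case 2
      then obtain y where "(x, y) \<in> \<theta>" "(y, z) \<in> \<eta>" by blast
      then have "alternates E (emb13 a) From_snd From_fst (emb13 b)"
        using 2 by (intro alternates.snoc[OF alternates.edge[of _ "Inr (Inl y)"]])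
          (auto simp: fst_iff snd_iff)
      then show ?thesis unfolding linked_def by blast
    qed
  qed
  ultimately show ?thesis
    by (intro set_eqI) (auto simp: pbr_comp_iff_linked E_def)
qed

theorem proposition6:
  "faithful_functor (rel_cat :: ('a set, ('a \<times> 'a) set) cat) (pbr_cat :: ('a set, ('a, 'a) pbr) cat)
     (\<lambda>X. X) (\<lambda>X Y \<theta>. Phi2 \<theta>)"
proof -
  interpret C: category "rel_cat :: ('a set, ('a \<times> 'a) set) cat" by (rule category_rel_cat)
  interpret D: category "pbr_cat :: ('a set, ('a, 'a) pbr) cat" by (rule category_pbr_cat)
  show ?thesis
  proof unfold_locales
    fix X Y :: "'a set" and \<theta> :: "('a \<times> 'a) set"
    assume "\<theta> \<in> hom rel_cat X Y"
    then show "Phi2 \<theta> \<in> hom pbr_cat X Y"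
      by (auto simp: rel_cat_def pbr_cat_def pbrs_def Phi2_def Phi1_def)
  next
    fix X :: "'a set"
    show "Phi2 (idn rel_cat X) = idn pbr_cat X"
      by (force simp: rel_cat_def pbr_cat_def pbr_id_def Phi2_def Phi1_def)
  qed (auto simp: rel_cat_def pbr_cat_def Phi2_relcomp Phi2_inject intro: inj_onI)
qed

end
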